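(* Let $d\in\mathbb{N}$ with $d\ge2$ and let $(p,q)\in[0,1]^2$ with $0<p+q<1$. The probability that the bond percolation game with parameter-pair $(p,q)$, played on the rooted $d$-regular tree $T_d$ starting from its root, results in a draw is $0$ if and only if the probabilistic tree automaton $B_{p,q}$ is ergodic.
   Context: $T_d$ is the rooted tree, with root $\phi$, in which every vertex has precisely $d$ children; edges are directed from parent to child. Bond percolation game with parameter-pair $(p,q)$ on $T_d$: each edge is independently labeled trap with probability $p$, target with probability $q$, safe with probability $1-p-q$. All labels are revealed to both players (perfect information). Two players alternately move a token, initially at $\phi$; a move takes the token from its current vertex along an edge to one of its children. A player who moves the token along a target edge wins immediately; a player who moves it along a trap edge loses immediately. If the game continues forever it is a draw. Both players play optimally: for a given realization of labels, the game is won (respectively lost) by the first player if the first (respectively second) player has a strategy guaranteeing a win for herself in finitely many rounds against any play of the opponent; otherwise it results in a draw. Probabilistic tree automaton (PTA): a PTA $A$ on $T_d$ consists of a finite alphabet $\mathcal{S}$ of states and a stochastic matrix $\vartheta_A$ of size $|\mathcal{S}|^d\times|\mathcal{S}|$: if the children $u_1,\dots,u_d$ of a vertex $u$ have states $a_1,\dots,a_d$, then $u$ gets state $b$ with probability $\vartheta_A((a_1,\dots,a_d),b)$. Let $L_n$ be the set of vertices in generation $n$ of $T_d$ ($L_0=\{\phi\}$). Conditionally on the states of the vertices in $L_{n+1}$, the states of the vertices in $L_n$ produced by $A$ are independent. For a deterministic boundary configuration $\sigma:L_n\to\mathcal{S}$, let $\mu_A(\sigma)$ denote the law of the random state of $\phi$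 obtained by starting from $\sigma$ on $L_n$ and iteratively applying $A$ to generations $n-1,n-2,\dots,0$. The PTA $A$ is ergodic if $$\limsup_{n\to\infty}\ \sup_{\sigma,\tau:L_n\to\mathcal{S}}\|\mu_A(\sigma)-\mu_A(\tau)\|_{\mathrm{TV}}=0,$$ where $\|\cdot\|_{\mathrm{TV}}$ is total variation distance. The PTA $B_{p,q}$ has alphabet $\mathcal{S}=\{W,L,D\}$ and, for $a_1,\dots,a_d\in\mathcal{S}$ with $i=|\{k:a_k=L\}|$ and $j=|\{k:a_k=D\}|$, $$\vartheta_{B_{p,q}}((a_1,\dots,a_d),b)=\begin{cases}1-p^{i}(1-q)^{d-i}& b=W,\\ p^{i}(1-q)^{d-i}-p^{i+j}(1-q)^{d-i-j}& b=D,\\ p^{i+j}(1-q)^{d-i-j}& b=L,\end{cases}$$ with $0^0=1$. *)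

theory Defs
  imports "HOL-Probability.Probability"
begin

section \<open>The rooted d-regular tree\<close>

text \<open>A vertex is the list of child indices read along the path from the root, so the root is
  \<open>[]\<close> and the children of \<open>v\<close> are \<open>v @ [k]\<close> with \<open>k < d\<close>.  Every edge is identified with its
  lower endpoint, hence with a vertex other than the root.\<close>

definition verts :: "nat \<Rightarrow> nat list set" where
  "verts d = lists {..<d}"

definition edges :: "nat \<Rightarrow> nat list set" where
  "edges d = verts d - {[]}"

definition level :: "nat \<Rightarrow> nat \<Rightarrow> nat list set" where
  "level d n = {v \<in> verts d. length v = n}"

section \<open>The bond percolation game\<close>

datatype label = Trap | Target | Safe

definition label_pmf :: "real \<Rightarrow> real \<Rightarrow> label pmf" where
  "label_pmf p q = embed_pmf (\<lambda>l. case l of Trap \<Rightarrow> p | Target \<Rightarrow> q | Safe \<Rightarrow> 1 - p - q)"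

definition labelling_measure :: "nat \<Rightarrow> real \<Rightarrow> real \<Rightarrow> (nat list \<Rightarrow> label) measure" where
  "labelling_measure d p q = Pi\<^sub>M (edges d) (\<lambda>_. measure_pmf (label_pmf p q))"

datatype player = First | Second

definition mover :: "nat \<Rightarrow> player" where
  "mover n = (if even n then First else Second)"

text \<open>A play is recorded by the sequence \<open>c\<close> of child indices chosen, also beyond the round in
  which the game is decided; the outcome only depends on the rounds up to the first edge
  that is not safe.  Round \<open>n\<close> traverses the edge \<open>position c (Suc n)\<close>.\<close>

definition position :: "(nat \<Rightarrow> nat) \<Rightarrow> nat \<Rightarrow> nat list" where
  "position c n = map c [0..<n]"

definition won_by :: "(nat list \<Rightarrow> label) \<Rightarrow> player \<Rightarrow> (nat \<Rightarrow> nat) \<Rightarrow> bool" where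
  "won_by \<omega> P c \<longleftrightarrow> (\<exists>n. (\<forall>m<n. \<omega> (position c (Suc m)) = Safe) \<and>
     \<omega> (position c (Suc n)) = (if mover n = P then Target else Trap))"

text \<open>In a tree the current vertex determines the history of the play, so a strategy chooses a
  child index at every vertex.\<close>

definition strategies :: "nat \<Rightarrow> (nat list \<Rightarrow> nat) set" where
  "strategies d = {s. \<forall>v\<in>verts d. s v < d}"

definition compatible_plays :: "nat \<Rightarrow> player \<Rightarrow> (nat list \<Rightarrow> nat) \<Rightarrow> (nat \<Rightarrow> nat) set" where
  "compatible_plays d P s =
     {c. (\<forall>n. c n < d) \<and> (\<forall>n. mover n = P \<longrightarrow> c n = s (position c n))}"

definition has_winning_strategy :: "nat \<Rightarrow> (nat list \<Rightarrow> label) \<Rightarrow> player \<Rightarrow> bool" where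
  "has_winning_strategy d \<omega> P \<longleftrightarrow>
     (\<exists>s\<in>strategies d. \<forall>c\<in>compatible_plays d P s. won_by \<omega> P c)"

definition game_draw :: "nat \<Rightarrow> (nat list \<Rightarrow> label) \<Rightarrow> bool" where
  "game_draw d \<omega> \<longleftrightarrow>
     \<not> has_winning_strategy d \<omega> First \<and> \<not> has_winning_strategy d \<omega> Second"

definition draw_event :: "nat \<Rightarrow> real \<Rightarrow> real \<Rightarrow> (nat list \<Rightarrow> label) set" where
  "draw_event d p q = {\<omega> \<in> space (labelling_measure d p q). game_draw d \<omega>}"

definition draw_prob :: "nat \<Rightarrow> real \<Rightarrow> real \<Rightarrow> real" where
  "draw_prob d p q = measure (labelling_measure d p q) (draw_event d p q)"

section \<open>Probabilistic tree automata\<close>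

text \<open>The stochastic matrix is given as a kernel from the list of the states of the \<open>d\<close> children
  to distributions on states; only its values on lists of length \<open>d\<close> matter.\<close>

type_synonym 's pta = "'s list \<Rightarrow> 's pmf"

definition pta_step ::
    "nat \<Rightarrow> 's pta \<Rightarrow> nat \<Rightarrow> (nat list \<Rightarrow> 's) \<Rightarrow> (nat list \<Rightarrow> 's) pmf" where
  "pta_step d \<theta> n \<sigma> =
     Pi_pmf (level d n) undefined (\<lambda>v. \<theta> (map (\<lambda>k. \<sigma> (v @ [k])) [0..<d]))"

primrec pta_law :: "nat \<Rightarrow> 's pta \<Rightarrow> nat \<Rightarrow> (nat list \<Rightarrow> 's) \<Rightarrow> 's pmf" where
  "pta_law d \<theta> 0 \<sigma> = return_pmf (\<sigma> [])"
| "pta_law d \<theta> (Suc n) \<sigma> = bind_pmf (pta_step d \<theta> n \<sigma>) (pta_law d \<theta> n)"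

definition tv_dist :: "'s pmf \<Rightarrow> 's pmf \<Rightarrow> real" where
  "tv_dist P Q = (SUP A. \<bar>measure_pmf.prob P A - measure_pmf.prob Q A\<bar>)"

definition pta_ergodic :: "nat \<Rightarrow> 's::finite pta \<Rightarrow> bool" where
  "pta_ergodic d \<theta> \<longleftrightarrow>
     limsup (\<lambda>n. SUP \<sigma>\<in>level d n \<rightarrow>\<^sub>E UNIV. SUP \<tau>\<in>level d n \<rightarrow>\<^sub>E UNIV.
       ereal (tv_dist (pta_law d \<theta> n \<sigma>) (pta_law d \<theta> n \<tau>))) = 0"

datatype state = W | L | D

instance state :: finite
proof
  have "(UNIV :: state set) \<subseteq> {W, L, D}" using state.exhaust by auto
  then show "finite (UNIV :: state set)" by (rule finite_subset) simp
qed

definition bond_matrix :: "nat \<Rightarrow> real \<Rightarrow> real \<Rightarrow> state list \<Rightarrow> state \<Rightarrow> real" where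
  "bond_matrix d p q as b =
     (let i = card {k. k < d \<and> as ! k = L}; j = card {k. k < d \<and> as ! k = D} in
      case b of
        W \<Rightarrow> 1 - p ^ i * (1 - q) ^ (d - i)
      | D \<Rightarrow> p ^ i * (1 - q) ^ (d - i) - p ^ (i + j) * (1 - q) ^ (d - i - j)
      | L \<Rightarrow> p ^ (i + j) * (1 - q) ^ (d - i - j))"

definition bond_pta :: "nat \<Rightarrow> real \<Rightarrow> real \<Rightarrow> state pta" where
  "bond_pta d p q as = embed_pmf (bond_matrix d p q as)"

section \<open>The definitions are not degenerate\<close>

text \<open>The two uses of \<open>embed_pmf\<close> are legitimate, and the draw event is measurable.\<close>

lemma pmf_label_pmf:
  assumes "0 \<le> p" "0 \<le> q" "p + q \<le> 1"
  shows "pmf (label_pmf p q) l = (case l of Trap \<Rightarrow> p | Target \<Rightarrow> q | Safe \<Rightarrow> 1 - p - q)"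
proof -
  have U: "(UNIV :: label set) = {Trap, Target, Safe}" using label.exhaust by auto
  show ?thesis unfolding label_pmf_def
    by (rule pmf_embed_pmf)
      (use assms in \<open>auto simp: nn_integral_count_space_finite U ennreal_plus[symmetric]
         simp del: ennreal_plus split: label.split\<close>)
qed

lemma pmf_bond_pta:
  assumes "0 \<le> p" "0 \<le> q" "p + q \<le> 1"
  shows "pmf (bond_pta d p q as) b = bond_matrix d p q as b"
proof -
  have U: "(UNIV :: state set) = {W, L, D}" using state.exhaust by auto
  define i where "i = card {k. k < d \<and> as ! k = L}"
  define j where "j = card {k. k < d \<and> as ! k = D}"
  have "i + j = card ({k. k < d \<and> as ! k = L} \<union> {k. k < d \<and> as ! k = D})"
    unfolding i_def j_def by (subst card_Un_disjoint) auto
  also have "\<dots> \<le> card {..<d}" by (intro card_mono) auto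
  finally have ij: "i + j \<le> d" by simp
  have 1: "p ^ i * (1 - q) ^ (d - i) \<le> 1"
    using assms by (intro mult_le_one power_le_one) auto
  have "p ^ j * (1 - q) ^ (d - i - j) \<le> (1 - q) ^ j * (1 - q) ^ (d - i - j)"
    using assms by (intro mult_right_mono power_mono) auto
  also have "\<dots> = (1 - q) ^ (d - i)"
    using ij by (simp add: power_add[symmetric])
  finally have 2: "p ^ (i + j) * (1 - q) ^ (d - i - j) \<le> p ^ i * (1 - q) ^ (d - i)"
    using assms by (simp add: power_add mult.assoc mult_left_mono)
  have nn: "0 \<le> bond_matrix d p q as b" for b
    using 1 2 assms
    by (auto simp: bond_matrix_def Let_def i_def[symmetric] j_def[symmetric] split: state.split)
  have sum: "(\<Sum>b\<in>UNIV. bond_matrix d p q as b) = 1"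
    by (simp add: U bond_matrix_def Let_def)
  show ?thesis unfolding bond_pta_def
    by (rule pmf_embed_pmf) (use nn sum in \<open>simp_all add: nn_integral_count_space_finite\<close>)
qed

text \<open>\<open>P\<close> can force a win within \<open>n\<close> rounds when the token is at \<open>v\<close>; an auxiliary notion for
  measurability only.\<close>

primrec wins_within :: "nat \<Rightarrow> player \<Rightarrow> nat \<Rightarrow> nat list \<Rightarrow> (nat list \<Rightarrow> label) \<Rightarrow> bool" where
  "wins_within d P 0 v \<omega> \<longleftrightarrow> False"
| "wins_within d P (Suc n) v \<omega> \<longleftrightarrow>
     (if mover (length v) = P
      then \<exists>k<d. \<omega> (v @ [k]) = Target \<or> \<omega> (v @ [k]) = Safe \<and> wins_within d P n (v @ [k]) \<omega>
      else \<forall>k<d. \<omega> (v @ [k]) = Trap \<or> \<omega> (v @ [k]) = Safe \<and> wins_within d P n (v @ [k]) \<omega>)"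

lemma wins_within_mono: "wins_within d P n v \<omega> \<Longrightarrow> n \<le> m \<Longrightarrow> wins_within d P m v \<omega>"
proof (induction n arbitrary: v m)
  case (Suc n)
  then obtain m' where m: "m = Suc m'" "n \<le> m'" by (cases m) auto
  have "wins_within d P n u \<omega> \<Longrightarrow> wins_within d P m' u \<omega>" for u
    using Suc.IH m by blast
  with Suc.prems show ?case unfolding m by (auto split: if_splits)
qed simp

lemma position_Suc: "position c (Suc n) = position c n @ [c n]"
  by (simp add: position_def)

lemma length_position [simp]: "length (position c n) = n"
  by (simp add: position_def)

lemma position_in_verts: "(\<And>n. c n < d) \<Longrightarrow> position c n \<in> verts d"
  by (auto simp: position_def verts_def)

lemma wins_within_imp_winning:
  assumes "wins_within d P n [] \<omega>" "0 < d"
  shows "has_winning_strategy d \<omega> P"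
proof -
  define r where "r v = (LEAST n. wins_within d P n v \<omega>)" for v
  define good where "good v k \<longleftrightarrow> k < d \<and> (\<omega> (v @ [k]) = Target \<or>
     \<omega> (v @ [k]) = Safe \<and> wins_within d P (r v - 1) (v @ [k]) \<omega>)" for v k
  define s where "s v = (if \<exists>k. good v k then SOME k. good v k else 0)" for v
  have s_good: "good v (s v)" if "\<exists>k. good v k" for v
    using someI_ex[OF that] that by (simp add: s_def)
  have "s \<in> strategies d"
    using s_good \<open>0 < d\<close> by (auto simp: strategies_def) (metis good_def s_def)
  moreover have "won_by \<omega> P c" if c: "c \<in> compatible_plays d P s" for c
  proof -
    have cd: "c n < d" for n using c by (simp add: compatible_plays_def)
    have "won_by \<omega> P c"
      if "wins_within d P n (position c m) \<omega>" "\<forall>l<m. \<omega> (position c (Suc l)) = Safe" for n m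
      using that
    proof (induction n arbitrary: m rule: less_induct)
      case (less n)
      let ?v = "position c m"
      have rw: "wins_within d P (r ?v) ?v \<omega>" and rn: "r ?v \<le> n"
        unfolding r_def using less.prems(1) by (auto intro: LeastI Least_le)
      then obtain r' where r': "r ?v = Suc r'" by (cases "r ?v") auto
      have step: "won_by \<omega> P c"
        if "\<omega> (position c (Suc m)) = Safe" "wins_within d P r' (position c (Suc m)) \<omega>"
        using less.IH[of r' "Suc m"] that less.prems(2) rn r' by (auto simp: less_Suc_eq)
      have stop: "won_by \<omega> P c"
        if "\<omega> (position c (Suc m)) = (if mover m = P then Target else Trap)"
        using that less.prems(2) by (auto simp: won_by_def)
      show ?case
      proof (cases "mover m = P")
        case True
        then have "\<exists>k. good ?v k" using rw unfolding r' good_def by auto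
        then have "good ?v (c m)" using s_good c True by (auto simp: compatible_plays_def)
        then show ?thesis using step stop True by (auto simp: good_def r' position_Suc)
      next
        case False
        then show ?thesis using rw cd[of m] step stop unfolding r' by (auto simp: position_Suc)
      qed
    qed
    from this[of n 0] show ?thesis using assms(1) by (simp add: position_def)
  qed
  ultimately show ?thesis by (auto simp: has_winning_strategy_def)
qed

lemma winning_imp_wins_within:
  assumes "has_winning_strategy d \<omega> P"
  shows "\<exists>n. wins_within d P n [] \<omega>"
proof (rule ccontr)
  assume not: "\<not> ?thesis"
  define H where "H v \<longleftrightarrow> (\<exists>n. wins_within d P n v \<omega>)" for v
  define bad where "bad v k \<longleftrightarrow> k < d \<and> \<omega> (v @ [k]) \<noteq> Trap \<and>
     (\<omega> (v @ [k]) = Safe \<longrightarrow> \<not> H (v @ [k]))" for v k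
  have own: "H v" if "mover (length v) = P" "k < d"
      "\<omega> (v @ [k]) = Target \<or> \<omega> (v @ [k]) = Safe \<and> H (v @ [k])" for v k
  proof -
    from that(3) obtain n where
      "\<omega> (v @ [k]) = Target \<or> \<omega> (v @ [k]) = Safe \<and> wins_within d P n (v @ [k]) \<omega>"
      by (auto simp: H_def)
    with that have "wins_within d P (Suc n) v \<omega>" by auto
    then show ?thesis unfolding H_def by blast
  qed
  have other: "\<exists>k. bad v k" if "mover (length v) \<noteq> P" "\<not> H v" for v
  proof (rule ccontr)
    assume nb: "\<not> (\<exists>k. bad v k)"
    then have "\<forall>k. \<exists>n. k < d \<longrightarrow> \<omega> (v @ [k]) = Trap \<or>
        \<omega> (v @ [k]) = Safe \<and> wins_within d P n (v @ [k]) \<omega>"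
      unfolding bad_def H_def by blast
    then obtain N where N: "\<And>k. k < d \<Longrightarrow> \<omega> (v @ [k]) = Trap \<or>
        \<omega> (v @ [k]) = Safe \<and> wins_within d P (N k) (v @ [k]) \<omega>"
      by metis
    have "N k \<le> Max (N ` {..<d})" if "k < d" for k using that by simp
    then have "wins_within d P (Suc (Max (N ` {..<d}))) v \<omega>"
      using N that(1) wins_within_mono by (simp, blast)
    with that(2) show False unfolding H_def by blast
  qed
  from assms obtain s where s: "s \<in> strategies d"
    and win: "\<And>c. c \<in> compatible_plays d P s \<Longrightarrow> won_by \<omega> P c"
    by (auto simp: has_winning_strategy_def)
  have "s [] < d" using s unfolding strategies_def verts_def by blast
  then have d: "0 < d" by simp
  define choice where "choice v = (if mover (length v) = P then s v
     else if \<exists>k. bad v k then SOME k. bad v k else 0)" for v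
  define path where "path = rec_nat [] (\<lambda>_ v. v @ [choice v])"
  define c where "c n = choice (path n)" for n
  have path: "path n = position c n" for n
    by (induction n) (simp_all add: path_def position_def c_def)
  have c: "c n = choice (position c n)" for n by (simp add: c_def path[symmetric])
  have bad_choice: "bad v (choice v)" if "mover (length v) \<noteq> P" "\<exists>k. bad v k" for v
    using someI_ex[OF that(2)] that by (simp add: choice_def)
  have choice_d: "choice v < d" if "v \<in> verts d" for v
  proof (cases "mover (length v) = P \<or> (\<nexists>k. bad v k)")
    case True
    then show ?thesis using s d that by (auto simp: choice_def strategies_def)
  next
    case False
    then show ?thesis using bad_choice by (auto simp: bad_def)
  qed
  have pv: "position c n \<in> verts d" for n
  proof (induction n)
    case (Suc n)
    then show ?case using choice_d[OF Suc] by (simp add: position_Suc c[of n, symmetric] verts_def)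
  qed (simp add: position_def verts_def)
  have cd: "c n < d" for n using choice_d[OF pv] c by simp
  have "c \<in> compatible_plays d P s"
    using cd c by (auto simp: compatible_plays_def choice_def)
  from win[OF this] obtain n where n: "\<forall>m<n. \<omega> (position c (Suc m)) = Safe"
    "\<omega> (position c (Suc n)) = (if mover n = P then Target else Trap)"
    by (auto simp: won_by_def)
  have step: "bad (position c m) (c m)"
    if "\<not> H (position c m)" "mover m \<noteq> P" for m
    using bad_choice other that c by simp
  have "\<not> H (position c m)" if "m \<le> n" for m
    using that
  proof (induction m)
    case 0
    then show ?case using not by (simp add: H_def position_def)
  next
    case (Suc m)
    then have nH: "\<not> H (position c m)" and safe: "\<omega> (position c m @ [c m]) = Safe"
      using n(1) by (auto simp: position_Suc[symmetric])
    show ?case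
    proof (cases "mover m = P")
      case True
      then show ?thesis using own[OF _ cd[of m]] nH safe by (auto simp: position_Suc)
    next
      case False
      then show ?thesis using step nH safe by (auto simp: bad_def position_Suc)
    qed
  qed
  then have nH: "\<not> H (position c n)" by simp
  show False
  proof (cases "mover n = P")
    case True
    then show ?thesis using own[OF _ cd[of n]] nH n(2) by (auto simp: position_Suc)
  next
    case False
    then show ?thesis using step[OF nH False] n(2) by (auto simp: bad_def position_Suc)
  qed
qed

lemma pred_wins_within:
  "v \<in> verts d \<Longrightarrow> {\<omega> \<in> space (labelling_measure d p q). wins_within d P n v \<omega>}
     \<in> sets (labelling_measure d p q)"
proof (induction n arbitrary: v)
  case (Suc n)
  let ?M = "labelling_measure d p q"
  have e: "v @ [k] \<in> edges d" "v @ [k] \<in> verts d" if "k < d" for k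
    using Suc.prems that by (auto simp: edges_def verts_def)
  have lab: "Measurable.pred ?M (\<lambda>\<omega>. \<omega> (v @ [k]) = l)" if "k < d" for k l
  proof -
    have "(\<lambda>\<omega>. \<omega> (v @ [k])) \<in> ?M \<rightarrow>\<^sub>M measure_pmf (label_pmf p q)"
      unfolding labelling_measure_def using e(1)[OF that] by (rule measurable_component_singleton)
    then have "(\<lambda>\<omega>. \<omega> (v @ [k])) \<in> ?M \<rightarrow>\<^sub>M count_space UNIV"
      by (simp cong: measurable_cong_sets)
    then show ?thesis by (rule pred_eq_const1) simp
  qed
  have IH: "Measurable.pred ?M (wins_within d P n (v @ [k]))" if "k < d" for k
    using Suc.IH[OF e(2)[OF that]] by (simp add: pred_def)
  have fin: "finite {..<d}" by simp
  have "Measurable.pred ?M (\<lambda>\<omega>. \<exists>k\<in>{..<d}. \<omega> (v @ [k]) = Target \<or>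
      \<omega> (v @ [k]) = Safe \<and> wins_within d P n (v @ [k]) \<omega>)"
    using lab IH by (intro pred_intros_finite(3,4) pred_intros_logic fin) auto
  moreover have "Measurable.pred ?M (\<lambda>\<omega>. \<forall>k\<in>{..<d}. \<omega> (v @ [k]) = Trap \<or>
      \<omega> (v @ [k]) = Safe \<and> wins_within d P n (v @ [k]) \<omega>)"
    using lab IH by (intro pred_intros_finite(3,4) pred_intros_logic fin) auto
  ultimately show ?case
    unfolding pred_def wins_within.simps Bex_def Ball_def lessThan_iff
    by (cases "mover (length v) = P") (simp_all only: simp_thms if_True if_False)
qed simp

lemma draw_event_measurable:
  assumes "0 < d"
  shows "draw_event d p q \<in> sets (labelling_measure d p q)"
proof -
  let ?M = "labelling_measure d p q"
  let ?A = "\<lambda>P n. {\<omega> \<in> space ?M. wins_within d P n [] \<omega>}"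
  have "has_winning_strategy d \<omega> P \<longleftrightarrow> (\<exists>n. wins_within d P n [] \<omega>)" for \<omega> P
    using wins_within_imp_winning[OF _ assms] winning_imp_wins_within by blast
  then have "draw_event d p q = space ?M - (\<Union>n. ?A First n) - (\<Union>n. ?A Second n)"
    by (auto simp: draw_event_def game_draw_def)
  also have "\<dots> \<in> sets ?M"
    using pred_wins_within[of "[]" d p q] by (intro sets.Diff sets.top sets.countable_UN) (auto simp: verts_def)
  finally show ?thesis .
qed

end

theory Submission
  imports Defs
begin

text \<open>The edge labels realise the automaton for all boundary configurations on generation \<open>n\<close>
  simultaneously, and with the all-\<open>D\<close> boundary the root is in state \<open>D\<close> exactly when neither
  player can force a win within \<open>n\<close> rounds; let \<open>\<delta>\<^sub>n\<close> be the probability of this event.  If the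
  all-\<open>D\<close> boundary already decides the root, every boundary yields the same root state, so the
  total variation distances in generation \<open>n\<close> are at most \<open>\<delta>\<^sub>n\<close>.  A boundary without \<open>D\<close> never
  creates a \<open>D\<close>, so comparing it with the all-\<open>D\<close> boundary shows that \<open>\<delta>\<^sub>n\<close> is attained.  Hence
  the limit superior defining ergodicity is the limit of \<open>\<delta>\<^sub>n\<close>, which is the draw probability.\<close>

section \<open>Finitely determined events in a product of discrete measures\<close>

text \<open>Values are countable and \<open>K\<close> is finite, so every subset of the product over
  \<open>K\<close> is measurable; restriction to \<open>K\<close> pulls such sets back to the
  product over \<open>I\<close>.\<close>

lemma sets_PiM_pmf_finitely_determined:
  fixes r :: "'i \<Rightarrow> 'b::countable pmf"
  assumes K: "finite K" "K \<subseteq> I"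
    and det: "\<And>\<omega> \<omega>'. (\<And>i. i \<in> K \<Longrightarrow> \<omega> i = \<omega>' i) \<Longrightarrow> P \<omega> = P \<omega>'"
  shows "{\<omega> \<in> space (Pi\<^sub>M I (\<lambda>i. measure_pmf (r i))). P \<omega>} \<in> sets (Pi\<^sub>M I (\<lambda>i. measure_pmf (r i)))"
    and "{f \<in> space (Pi\<^sub>M K (\<lambda>i. measure_pmf (r i))). P f} \<in> sets (Pi\<^sub>M K (\<lambda>i. measure_pmf (r i)))"
proof -
  let ?M = "Pi\<^sub>M I (\<lambda>i. measure_pmf (r i))" and ?N = "Pi\<^sub>M K (\<lambda>i. measure_pmf (r i))"
  have "sets ?N = sets (Pi\<^sub>M K (\<lambda>_. count_space UNIV))"
    by (rule sets_PiM_cong) auto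
  also have "\<dots> = Pow (K \<rightarrow>\<^sub>E UNIV)"
    using K(1) by (simp add: count_space_PiM_finite)
  finally have sN: "sets ?N = Pow (space ?N)"
    by (simp add: space_PiM)
  then show A: "{f \<in> space ?N. P f} \<in> sets ?N"
    by blast
  have "(\<lambda>\<omega>. restrict \<omega> K) -` {f \<in> space ?N. P f} \<inter> space ?M \<in> sets ?M"
    by (rule measurable_sets[OF measurable_restrict_subset[OF K(2)] A])
  also have "(\<lambda>\<omega>. restrict \<omega> K) -` {f \<in> space ?N. P f} \<inter> space ?M = {\<omega> \<in> space ?M. P \<omega>}"
  proof -
    have "P (restrict \<omega> K) = P \<omega>" for \<omega> by (rule det) simp
    then show ?thesis by (auto simp: space_PiM)
  qed
  finally show "{\<omega> \<in> space ?M. P \<omega>} \<in> sets ?M" .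
qed

lemma indep_vars_PiM_pmf:
  "prob_space.indep_vars (Pi\<^sub>M I (\<lambda>i. measure_pmf (r i))) (\<lambda>i. measure_pmf (r i)) (\<lambda>i \<omega>. \<omega> i) I"
proof (cases "I = {}")
  \<comment> \<open>The criterion used below wants a nonempty index set; over the empty one
    independence is vacuous.\<close>
  case True
  interpret prob_space "Pi\<^sub>M I (\<lambda>i. measure_pmf (r i))"
    by (intro prob_space_PiM) (rule measure_pmf.prob_space_axioms)
  show ?thesis unfolding indep_vars_def indep_sets_def using True by simp
next
  case False
  let ?M = "Pi\<^sub>M I (\<lambda>i. measure_pmf (r i))"
  interpret prob_space ?M
    by (intro prob_space_PiM) (rule measure_pmf.prob_space_axioms)
  \<comment> \<open>The joint map of all coordinates is \<open>restrict \<omega> I\<close>, the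
    identity on the extensional space. So the joint law is \<open>?M\<close> itself, which is the
    product of its marginals; this is the criterion for independence.\<close>
  have "distr ?M ?M (\<lambda>\<omega>. restrict \<omega> I) = distr ?M ?M (\<lambda>\<omega>. \<omega>)"
    by (rule distr_cong) (auto simp: space_PiM)
  also have "\<dots> = ?M"
    by (rule distr_id)
  also have "\<dots> = Pi\<^sub>M I (\<lambda>i. distr ?M (measure_pmf (r i)) (\<lambda>\<omega>. \<omega> i))"
    by (intro PiM_cong refl distr_PiM_component[symmetric] measure_pmf.prob_space_axioms) auto
  finally show ?thesis
    by (subst indep_vars_iff_distr_eq_PiM'[OF False]) (auto simp: measurable_component_singleton)
qed

text \<open>Restrictions to disjoint blocks of coordinates are independent, and each
  \<open>P j\<close> is an event about the block \<open>K j\<close> alone.\<close>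

lemma prob_PiM_pmf_blocks:
  fixes r :: "'i \<Rightarrow> 'b::countable pmf" and I :: "'i set" and K :: "'j \<Rightarrow> 'i set"
  defines "M \<equiv> Pi\<^sub>M I (\<lambda>i. measure_pmf (r i))"
  assumes J: "finite J" "J \<noteq> {}"
    and K: "\<And>j. j \<in> J \<Longrightarrow> finite (K j)" "\<And>j. j \<in> J \<Longrightarrow> K j \<subseteq> I" "disjoint_family_on K J"
    and det: "\<And>j \<omega> \<omega>'. j \<in> J \<Longrightarrow> (\<And>i. i \<in> K j \<Longrightarrow> \<omega> i = \<omega>' i) \<Longrightarrow> P j \<omega> = P j \<omega>'"
  shows "measure M {\<omega> \<in> space M. \<forall>j\<in>J. P j \<omega>} = (\<Prod>j\<in>J. measure M {\<omega> \<in> space M. P j \<omega>})"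
proof -
  interpret prob_space M
    unfolding M_def by (intro prob_space_PiM) (rule measure_pmf.prob_space_axioms)
  let ?N = "\<lambda>j. Pi\<^sub>M (K j) (\<lambda>i. measure_pmf (r i))"
  have ind: "indep_vars ?N (\<lambda>j \<omega>. restrict \<omega> (K j)) J"
    using indep_vars_restrict[OF indep_vars_PiM_pmf[of I r, folded M_def] K(2,3)] by simp
  have eq: "(\<lambda>\<omega>. restrict \<omega> (K j)) -` {f \<in> space (?N j). P j f} \<inter> space M
      = {\<omega> \<in> space M. P j \<omega>}" if "j \<in> J" for j
  proof -
    have "P j (restrict \<omega> (K j)) = P j \<omega>" for \<omega> by (rule det[OF that]) simp
    then show ?thesis by (auto simp: space_PiM)
  qed
  have "prob (\<Inter>j\<in>J. (\<lambda>\<omega>. restrict \<omega> (K j)) -` {f \<in> space (?N j). P j f} \<inter> space M)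
      = (\<Prod>j\<in>J. prob ((\<lambda>\<omega>. restrict \<omega> (K j)) -` {f \<in> space (?N j). P j f} \<inter> space M))"
  proof (rule indep_varsD_finite[OF ind J(2,1)])
    fix j assume j: "j \<in> J"
    show "{f \<in> space (?N j). P j f} \<in> sets (?N j)"
      by (rule sets_PiM_pmf_finitely_determined(2)[OF K(1)[OF j] subset_refl]) (rule det[OF j])
  qed
  moreover have "(\<Inter>j\<in>J. (\<lambda>\<omega>. restrict \<omega> (K j)) -` {f \<in> space (?N j). P j f} \<inter> space M)
      = {\<omega> \<in> space M. \<forall>j\<in>J. P j \<omega>}"
    using J(2) by (subst INF_cong[OF refl eq]) auto
  moreover have "(\<Prod>j\<in>J. prob ((\<lambda>\<omega>. restrict \<omega> (K j)) -` {f \<in> space (?N j). P j f} \<inter> space M))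
      = (\<Prod>j\<in>J. prob {\<omega> \<in> space M. P j \<omega>})"
    by (intro prod.cong refl arg_cong[where f = prob] eq)
  ultimately show ?thesis by (simp only:)
qed

section \<open>The automaton driven by the edge labels\<close>

text \<open>States are relative to the player about to move, so a safe edge to an \<open>L\<close>
  child wins. The labels below \<open>v\<close> act as the randomness of one automaton
  update.\<close>

definition game_step :: "nat \<Rightarrow> (nat list \<Rightarrow> label) \<Rightarrow> (nat list \<Rightarrow> state) \<Rightarrow> nat list \<Rightarrow> state" where
  "game_step d \<omega> \<sigma> v =
     (if \<exists>k<d. \<omega> (v @ [k]) = Target \<or> \<omega> (v @ [k]) = Safe \<and> \<sigma> (v @ [k]) = L then W
      else if \<forall>k<d. \<omega> (v @ [k]) = Trap \<or> \<omega> (v @ [k]) = Safe \<and> \<sigma> (v @ [k]) = W then L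
      else D)"

lemma game_step_eq_W:
  "game_step d \<omega> \<sigma> v = W \<longleftrightarrow>
    (\<exists>k<d. \<omega> (v @ [k]) = Target \<or> \<omega> (v @ [k]) = Safe \<and> \<sigma> (v @ [k]) = L)"
  by (simp add: game_step_def)

lemma game_step_eq_L:
  "game_step d \<omega> \<sigma> v = L \<longleftrightarrow>
    (\<forall>k<d. \<omega> (v @ [k]) = Trap \<or> \<omega> (v @ [k]) = Safe \<and> \<sigma> (v @ [k]) = W)"
  by (auto simp: game_step_def)

text \<open>The restriction keeps intermediate configurations \<open>undefined\<close> off
  generation \<open>n\<close>, like the samples of \<open>pta_step\<close>, so they range over a
  finite set.\<close>

primrec root_state :: "nat \<Rightarrow> (nat list \<Rightarrow> label) \<Rightarrow> nat \<Rightarrow> (nat list \<Rightarrow> state) \<Rightarrow> state" where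
  "root_state d \<omega> 0 \<sigma> = \<sigma> []"
| "root_state d \<omega> (Suc n) \<sigma> = root_state d \<omega> n (restrict (game_step d \<omega> \<sigma>) (level d n))"

section \<open>Dependence of the root state on labels and boundary\<close>

lemma level_0 [simp]: "level d 0 = {[]}"
  by (auto simp: level_def verts_def)

lemma finite_level [simp]: "finite (level d n)"
  unfolding level_def verts_def using finite_lists_length_eq[of "{..<d}" n]
  by (simp add: lists_eq_set)

lemma child_in_level: "v \<in> level d n \<Longrightarrow> k < d \<Longrightarrow> v @ [k] \<in> level d (Suc n)"
  by (auto simp: level_def verts_def)

lemma child_in_edges: "v \<in> verts d \<Longrightarrow> k < d \<Longrightarrow> v @ [k] \<in> edges d"
  by (auto simp: edges_def verts_def)

text \<open>Only edges ending in generations up to \<open>n\<close> are consulted. This yields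
  measurability and, later, independence from the labels just below generation
  \<open>n\<close>.\<close>

lemma root_state_cong:
  assumes "\<And>e. e \<in> edges d \<Longrightarrow> length e \<le> n \<Longrightarrow> \<omega> e = \<omega>' e"
  shows "root_state d \<omega> n \<sigma> = root_state d \<omega>' n \<sigma>"
  using assms
proof (induction n arbitrary: \<sigma>)
  case (Suc n)
  have "\<omega> (v @ [k]) = \<omega>' (v @ [k])" if "v \<in> level d n" "k < d" for v k
    using that child_in_edges[of v d k] by (intro Suc.prems) (auto simp: level_def)
  then have "restrict (game_step d \<omega> \<sigma>) (level d n) = restrict (game_step d \<omega>' \<sigma>) (level d n)"
    by (intro restrict_ext) (simp add: game_step_def cong: conj_cong)
  with Suc show ?case by simp
qed simp

text \<open>The flat order with least element \<open>D\<close>: resolving draws at the boundary can only resolve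
  draws at the root.\<close>

lemma root_state_refines:
  assumes "\<And>v. v \<in> level d n \<Longrightarrow> \<sigma> v = D \<or> \<sigma> v = \<tau> v"
  shows "root_state d \<omega> n \<sigma> = D \<or> root_state d \<omega> n \<sigma> = root_state d \<omega> n \<tau>"
  using assms
proof (induction n arbitrary: \<sigma> \<tau>)
  case (Suc n)
  have "game_step d \<omega> \<sigma> v = D \<or> game_step d \<omega> \<sigma> v = game_step d \<omega> \<tau> v" if "v \<in> level d n" for v
  proof -
    have c: "\<sigma> (v @ [k]) = D \<or> \<sigma> (v @ [k]) = \<tau> (v @ [k])" if "k < d" for k
      using Suc.prems child_in_level[OF \<open>v \<in> level d n\<close> that] by blast
    show ?thesis
    proof (cases "game_step d \<omega> \<sigma> v")
      case W
      then obtain k where "k < d"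
        "\<omega> (v @ [k]) = Target \<or> \<omega> (v @ [k]) = Safe \<and> \<sigma> (v @ [k]) = L"
        unfolding game_step_eq_W by blast
      with c[of k] have "game_step d \<omega> \<tau> v = W"
        unfolding game_step_eq_W by auto
      then show ?thesis by (simp add: W)
    next
      case L
      then have "\<omega> (v @ [k]) = Trap \<or> \<omega> (v @ [k]) = Safe \<and> \<sigma> (v @ [k]) = W" if "k < d" for k
        using that unfolding game_step_eq_L by blast
      with c have "\<omega> (v @ [k]) = Trap \<or> \<omega> (v @ [k]) = Safe \<and> \<tau> (v @ [k]) = W" if "k < d" for k
        using that by force
      then have "game_step d \<omega> \<tau> v = L"
        unfolding game_step_eq_L by blast
      then show ?thesis by (simp add: L)
    qed simp
  qed
  then show ?case
    unfolding root_state.simps by (intro Suc.IH) simp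
qed simp

text \<open>Without \<open>D\<close> among the children, an edge that does not win for the mover is
  a trap or leads safely to \<open>W\<close>; failing the test for \<open>W\<close> thus means
  passing the one for \<open>L\<close>.\<close>

lemma root_state_neq_D:
  assumes "\<And>v. v \<in> level d n \<Longrightarrow> \<sigma> v \<noteq> D"
  shows "root_state d \<omega> n \<sigma> \<noteq> D"
  using assms
proof (induction n arbitrary: \<sigma>)
  case (Suc n)
  have "game_step d \<omega> \<sigma> v \<noteq> D" if "v \<in> level d n" for v
  proof -
    have "\<sigma> (v @ [k]) = W \<or> \<sigma> (v @ [k]) = L" if "k < d" for k
      using Suc.prems[OF child_in_level[OF \<open>v \<in> level d n\<close> that]] by (cases "\<sigma> (v @ [k])") auto
    then have "\<omega> (v @ [k]) = Trap \<or> \<omega> (v @ [k]) = Safe \<and> \<sigma> (v @ [k]) = W"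
      if "k < d" "game_step d \<omega> \<sigma> v \<noteq> W" for k
      using that by (cases "\<omega> (v @ [k])") (auto simp: game_step_eq_W)
    then have "game_step d \<omega> \<sigma> v = L" if "game_step d \<omega> \<sigma> v \<noteq> W"
      using that unfolding game_step_eq_L by blast
    then show ?thesis by force
  qed
  then show ?case by (auto intro!: Suc.IH)
qed simp

section \<open>The value of the game with finitely many rounds left, seen by the player to
  move\<close>

definition horizon_state :: "nat \<Rightarrow> (nat list \<Rightarrow> label) \<Rightarrow> nat \<Rightarrow> nat list \<Rightarrow> state" where
  "horizon_state d \<omega> n v =
     (if wins_within d (mover (length v)) n v \<omega> then W
      else if wins_within d (mover (Suc (length v))) n v \<omega> then L else D)"

lemma mover_Suc_neq: "mover (Suc n) \<noteq> mover n"
  by (simp add: mover_def)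

lemma mover_Suc_Suc: "mover (Suc (Suc n)) = mover n"
  by (simp add: mover_def)

text \<open>One of the two players moves at \<open>v\<close>; an edge that wins for the mover
  refutes the universal clause of the opponent, by induction if it is safe.\<close>

lemma wins_within_exclusive:
  "P \<noteq> Q \<Longrightarrow> wins_within d P n v \<omega> \<Longrightarrow> \<not> wins_within d Q n v \<omega>"
proof (induction n arbitrary: v P Q)
  case (Suc n)
  have IH: "wins_within d P n u \<omega> \<Longrightarrow> \<not> wins_within d Q n u \<omega>" for u
    using Suc.IH Suc.prems(1) by blast
  have "mover (length v) = P \<or> mover (length v) = Q"
    using Suc.prems(1) by (metis player.exhaust)
  then show ?case
    using Suc.prems IH by (auto 0 3)
qed simp

text \<open>\<open>game_step\<close> is backward induction and adds one round to the
  horizon.\<close>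

lemma game_step_horizon_state:
  assumes "\<And>k. k < d \<Longrightarrow> \<sigma> (v @ [k]) = horizon_state d \<omega> n (v @ [k])"
  shows "game_step d \<omega> \<sigma> v = horizon_state d \<omega> (Suc n) v"
proof -
  let ?P = "mover (length v)" and ?Q = "mover (Suc (length v))"
  \<comment> \<open>At a child the roles swap: \<open>?Q\<close> moves and \<open>?P\<close> is the
    opponent. As \<open>horizon_state\<close> tests the mover first, exclusivity is what makes
    \<open>L\<close> equivalent to a forced win of \<open>?P\<close>.\<close>
  have "\<sigma> (v @ [k]) = L \<longleftrightarrow> wins_within d ?P n (v @ [k]) \<omega>"
    "\<sigma> (v @ [k]) = W \<longleftrightarrow> wins_within d ?Q n (v @ [k]) \<omega>" if "k < d" for k
    using assms[OF that] wins_within_exclusive[OF mover_Suc_neq]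
    by (auto simp: horizon_state_def mover_Suc_Suc)
  then show ?thesis
    unfolding game_step_def horizon_state_def
    by (simp add: mover_Suc_neq mover_Suc_neq[symmetric] cong: conj_cong)
qed

text \<open>Each generation climbed adds one round to the horizon, so the induction leaves
  \<open>k\<close> arbitrary.\<close>

lemma root_state_horizon_state:
  assumes "\<And>v. v \<in> level d n \<Longrightarrow> \<sigma> v = horizon_state d \<omega> k v"
  shows "root_state d \<omega> n \<sigma> = horizon_state d \<omega> (n + k) []"
  using assms
proof (induction n arbitrary: \<sigma> k)
  case (Suc n)
  have "root_state d \<omega> n (restrict (game_step d \<omega> \<sigma>) (level d n)) = horizon_state d \<omega> (n + Suc k) []"
    by (intro Suc.IH) (auto intro!: game_step_horizon_state Suc.prems child_in_level)
  then show ?case by simp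
qed simp

lemma root_state_D_iff:
  assumes "\<And>v. v \<in> level d n \<Longrightarrow> \<sigma> v = D"
  shows "root_state d \<omega> n \<sigma> = D \<longleftrightarrow>
    \<not> wins_within d First n [] \<omega> \<and> \<not> wins_within d Second n [] \<omega>"
proof -
  \<comment> \<open>Nobody can force a win in 0 rounds, so the all-\<open>D\<close> boundary is the
    value at horizon \<open>0\<close>.\<close>
  have "root_state d \<omega> n \<sigma> = horizon_state d \<omega> (n + 0) []"
    by (rule root_state_horizon_state) (simp add: horizon_state_def assms)
  then show ?thesis by (auto simp: horizon_state_def mover_def)
qed

section \<open>Law of the root state\<close>

instance label :: countable
  by countable_datatype

lemma UNIV_label: "(UNIV :: label set) = {Trap, Target, Safe}"
  using label.exhaust by auto

lemma finite_edges_le: "finite {e \<in> edges d. length e \<le> n}"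
  by (rule finite_subset[OF _ finite_lists_length_le[of "{..<d}" n]])
    (auto simp: edges_def verts_def)

locale bond_percolation =
  fixes d :: nat and p q :: real
  assumes pq: "0 \<le> p" "0 \<le> q" "p + q \<le> 1"
begin

abbreviation "M \<equiv> labelling_measure d p q"

sublocale prob_space M
  unfolding labelling_measure_def
  by (intro prob_space_PiM) (rule measure_pmf.prob_space_axioms)

lemma sets_finitely_determined:
  assumes "finite K" "K \<subseteq> edges d"
    and "\<And>\<omega> \<omega>'. (\<And>e. e \<in> K \<Longrightarrow> \<omega> e = \<omega>' e) \<Longrightarrow> P \<omega> = P \<omega>'"
  shows "{\<omega> \<in> space M. P \<omega>} \<in> sets M"
  unfolding labelling_measure_def by (rule sets_PiM_pmf_finitely_determined(1)[OF assms])

lemma sets_root_state: "{\<omega> \<in> space M. R (root_state d \<omega> n \<sigma>)} \<in> sets M"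
proof (rule sets_finitely_determined[OF finite_edges_le])
  fix \<omega> \<omega>' :: "nat list \<Rightarrow> label"
  assume "\<And>e. e \<in> {e \<in> edges d. length e \<le> n} \<Longrightarrow> \<omega> e = \<omega>' e"
  then have "root_state d \<omega> n \<sigma> = root_state d \<omega>' n \<sigma>"
    by (intro root_state_cong) auto
  then show "R (root_state d \<omega> n \<sigma>) = R (root_state d \<omega>' n \<sigma>)" by simp
qed auto

section \<open>One update of the automaton from the labels below a vertex\<close>

lemma prob_children_labels:
  assumes "v \<in> verts d"
  shows "prob {\<omega> \<in> space M. \<forall>k<d. \<omega> (v @ [k]) \<in> S k}
    = (\<Prod>k<d. measure_pmf.prob (label_pmf p q) (S k))"
proof -
  interpret P: product_prob_space "\<lambda>_. measure_pmf (label_pmf p q)" "edges d"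
    by unfold_locales
  let ?J = "(\<lambda>k. v @ [k]) ` {..<d}"
  \<comment> \<open>The product formula is indexed by edges; \<open>last e\<close> recovers the
    child index from the edge \<open>v @ [k]\<close>.\<close>
  have "emeasure M {\<omega> \<in> space M. \<forall>e\<in>?J. \<omega> e \<in> S (last e)}
      = (\<Prod>e\<in>?J. emeasure (measure_pmf (label_pmf p q)) (S (last e)))"
    unfolding labelling_measure_def
    by (intro P.emeasure_PiM_Collect) (auto intro: child_in_edges[OF assms])
  also have "\<dots> = (\<Prod>k<d. emeasure (measure_pmf (label_pmf p q)) (S k))"
    by (subst prod.reindex) (auto simp: inj_on_def)
  also have "\<dots> = ennreal (\<Prod>k<d. measure_pmf.prob (label_pmf p q) (S k))"
    by (simp add: measure_pmf.emeasure_eq_measure prod_ennreal)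
  also have "{\<omega> \<in> space M. \<forall>e\<in>?J. \<omega> e \<in> S (last e)} = {\<omega> \<in> space M. \<forall>k<d. \<omega> (v @ [k]) \<in> S k}"
    by auto
  finally show ?thesis
    by (simp add: emeasure_eq_measure prod_nonneg)
qed

lemma prob_trap: "measure_pmf.prob (label_pmf p q) {Trap} = p"
  and prob_not_target: "measure_pmf.prob (label_pmf p q) {Trap, Safe} = 1 - q"
  using pq by (simp_all add: measure_measure_pmf_finite pmf_label_pmf)

text \<open>\<open>R\<close> marks the children to which a safe edge is excluded: their edges must
  be traps, with probability \<open>p\<close>, and the other edges merely not targets, with
  probability \<open>1 - q\<close>.\<close>

lemma prob_children_trap_or:
  assumes "v \<in> verts d"
  shows "prob {\<omega> \<in> space M. \<forall>k<d. \<omega> (v @ [k]) = Trap \<or> \<omega> (v @ [k]) = Safe \<and> \<not> R k}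
    = p ^ card {k. k < d \<and> R k} * (1 - q) ^ (d - card {k. k < d \<and> R k})"
proof -
  have "{\<omega> \<in> space M. \<forall>k<d. \<omega> (v @ [k]) = Trap \<or> \<omega> (v @ [k]) = Safe \<and> \<not> R k}
      = {\<omega> \<in> space M. \<forall>k<d. \<omega> (v @ [k]) \<in> (if R k then {Trap} else {Trap, Safe})}"
    by auto
  also have "prob \<dots> = (\<Prod>k<d. if R k then p else 1 - q)"
    by (subst prob_children_labels[OF assms])
      (auto intro!: prod.cong simp: prob_trap prob_not_target)
  also have "\<dots> = p ^ card {k. k < d \<and> R k} * (1 - q) ^ card {k. k < d \<and> \<not> R k}"
    by (subst prod.If_cases) (simp_all add: Int_def Compl_eq)
  also have "card {k. k < d \<and> \<not> R k} = d - card {k. k < d \<and> R k}"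
  proof -
    have "{k. k < d \<and> \<not> R k} = {..<d} - {k. k < d \<and> R k}" by auto
    also have "card \<dots> = card {..<d} - card {k. k < d \<and> R k}"
      by (rule card_Diff_subset) auto
    finally show ?thesis by simp
  qed
  finally show ?thesis .
qed

text \<open>\<open>A\<close> says that no edge wins, \<open>B\<close> that all edges lose. A safe
  edge breaks \<open>A\<close> only at an \<open>L\<close> child, but breaks \<open>B\<close> at
  \<open>L\<close> and \<open>D\<close> children, so the exponents are \<open>i\<close> and
  \<open>i + j\<close>; state \<open>D\<close> is \<open>A - B\<close>.\<close>

lemma prob_game_step:
  assumes v: "v \<in> verts d"
  shows "prob {\<omega> \<in> space M. game_step d \<omega> \<sigma> v = s}
    = pmf (bond_pta d p q (map (\<lambda>k. \<sigma> (v @ [k])) [0..<d])) s"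
proof -
  let ?as = "map (\<lambda>k. \<sigma> (v @ [k])) [0..<d]"
  define i where "i = card {k. k < d \<and> \<sigma> (v @ [k]) = L}"
  define j where "j = card {k. k < d \<and> \<sigma> (v @ [k]) = D}"
  have neq_W: "s \<noteq> W \<longleftrightarrow> s = L \<or> s = D" for s
    by (cases s) auto
  have ij: "i + j = card {k. k < d \<and> \<sigma> (v @ [k]) \<noteq> W}"
  proof -
    have "{k. k < d \<and> \<sigma> (v @ [k]) \<noteq> W}
        = {k. k < d \<and> \<sigma> (v @ [k]) = L} \<union> {k. k < d \<and> \<sigma> (v @ [k]) = D}"
      by (auto simp: neq_W)
    also have "card \<dots> = i + j"
      unfolding i_def j_def by (rule card_Un_disjoint) auto
    finally show ?thesis ..
  qed
  have idx: "{k. k < d \<and> ?as ! k = s} = {k. k < d \<and> \<sigma> (v @ [k]) = s}" for s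
    by (intro Collect_cong conj_cong refl) simp
  have bm: "bond_matrix d p q ?as s = (case s of
        W \<Rightarrow> 1 - p ^ i * (1 - q) ^ (d - i)
      | D \<Rightarrow> p ^ i * (1 - q) ^ (d - i) - p ^ (i + j) * (1 - q) ^ (d - (i + j))
      | L \<Rightarrow> p ^ (i + j) * (1 - q) ^ (d - (i + j)))" for s
    unfolding bond_matrix_def idx i_def[symmetric] j_def[symmetric] Let_def diff_diff_left ..
  define A where "A = {\<omega> \<in> space M. \<forall>k<d. \<omega> (v @ [k]) = Trap \<or>
    \<omega> (v @ [k]) = Safe \<and> \<not> \<sigma> (v @ [k]) = L}"
  define B where "B = {\<omega> \<in> space M. \<forall>k<d. \<omega> (v @ [k]) = Trap \<or>
    \<omega> (v @ [k]) = Safe \<and> \<not> \<sigma> (v @ [k]) \<noteq> W}"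
  have pA: "prob A = p ^ i * (1 - q) ^ (d - i)"
    unfolding A_def i_def by (rule prob_children_trap_or[OF v])
  have pB: "prob B = p ^ (i + j) * (1 - q) ^ (d - (i + j))"
    unfolding B_def ij by (rule prob_children_trap_or[OF v])
  have child: "(\<lambda>k. v @ [k]) ` {..<d} \<subseteq> edges d"
    using child_in_edges[OF v] by auto
  have AB: "A \<in> sets M" "B \<in> sets M" "B \<subseteq> A"
    unfolding A_def B_def
    by (rule sets_finitely_determined[OF _ child]; simp) +
      auto
  have notW: "game_step d \<omega> \<sigma> v \<noteq> W \<longleftrightarrow>
      (\<forall>k<d. \<omega> (v @ [k]) = Trap \<or> \<omega> (v @ [k]) = Safe \<and> \<not> \<sigma> (v @ [k]) = L)" for \<omega>
  proof -
    have "l = Trap \<or> l = Safe \<and> \<not> R \<longleftrightarrow> \<not> (l = Target \<or> l = Safe \<and> R)" for l R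
      by (cases l) auto
    then show ?thesis by (simp add: game_step_eq_W)
  qed
  have isL: "game_step d \<omega> \<sigma> v = L \<longleftrightarrow>
      (\<forall>k<d. \<omega> (v @ [k]) = Trap \<or> \<omega> (v @ [k]) = Safe \<and> \<not> \<sigma> (v @ [k]) \<noteq> W)" for \<omega>
    by (simp add: game_step_eq_L)
  have A': "A = {\<omega> \<in> space M. game_step d \<omega> \<sigma> v \<noteq> W}" unfolding A_def notW ..
  have B': "B = {\<omega> \<in> space M. game_step d \<omega> \<sigma> v = L}" unfolding B_def isL ..
  have "prob {\<omega> \<in> space M. game_step d \<omega> \<sigma> v = s} = bond_matrix d p q ?as s"
  proof (cases s)
    case W
    have "{\<omega> \<in> space M. game_step d \<omega> \<sigma> v = W} = space M - A" unfolding A' by auto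
    then show ?thesis using prob_compl[OF AB(1)] by (simp add: W bm pA)
  next
    case L
    then show ?thesis using pB by (simp add: bm B')
  next
    case D
    have "{\<omega> \<in> space M. game_step d \<omega> \<sigma> v = D} = A - B"
      unfolding A' B' by (auto simp: neq_W)
    then show ?thesis using finite_measure_Diff[OF AB] by (simp add: D bm pA pB)
  qed
  then show ?thesis using pmf_bond_pta[OF pq, of d] by simp
qed

section \<open>Joint law of one update and the remaining evolution\<close>

lemma prob_step_and_root_state:
  assumes \<tau>: "\<tau> \<in> level d n \<rightarrow>\<^sub>E UNIV"
  shows "prob {\<omega> \<in> space M. restrict (game_step d \<omega> \<sigma>) (level d n) = \<tau> \<and> root_state d \<omega> n \<tau> = s}
    = pmf (pta_step d (bond_pta d p q) n \<sigma>) \<tau> * prob {\<omega> \<in> space M. root_state d \<omega> n \<tau> = s}"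
proof -
  \<comment> \<open>The steps at different vertices of generation \<open>n\<close> and the subsequent evolution towards the
    root read disjoint sets of labels.\<close>
  define J where "J = insert None (Some ` level d n)"
  define K where "K j = (case j of None \<Rightarrow> {e \<in> edges d. length e \<le> n}
    | Some v \<Rightarrow> (\<lambda>k. v @ [k]) ` {..<d})" for j
  define P where "P j \<omega> = (case j of None \<Rightarrow> root_state d \<omega> n \<tau> = s
    | Some v \<Rightarrow> game_step d \<omega> \<sigma> v = \<tau> v)" for j \<omega>
  have "restrict (game_step d \<omega> \<sigma>) (level d n) = \<tau> \<longleftrightarrow>
      (\<forall>v\<in>level d n. game_step d \<omega> \<sigma> v = \<tau> v)" for \<omega>
    using \<tau> by (auto simp: fun_eq_iff PiE_def extensional_def)
  then have "{\<omega> \<in> space M. restrict (game_step d \<omega> \<sigma>) (level d n) = \<tau> \<and> root_state d \<omega> n \<tau> = s}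
      = {\<omega> \<in> space M. \<forall>j\<in>J. P j \<omega>}"
    by (auto simp: J_def P_def)
  also have "prob \<dots> = (\<Prod>j\<in>J. prob {\<omega> \<in> space M. P j \<omega>})"
    unfolding labelling_measure_def
  proof (rule prob_PiM_pmf_blocks[where K = K])
    show "finite J" "J \<noteq> {}" by (simp_all add: J_def)
    show "finite (K j)" if "j \<in> J" for j
      using that finite_edges_le by (auto simp: J_def K_def)
    show "K j \<subseteq> edges d" if "j \<in> J" for j
      using that child_in_edges by (auto simp: J_def K_def level_def)
    \<comment> \<open>Child edges have length \<open>Suc n\<close>, beyond those in the
      \<open>None\<close> block, and each determines its parent.\<close>
    show "disjoint_family_on K J"
      by (auto simp: disjoint_family_on_def J_def K_def level_def)
    show "P j \<omega> = P j \<omega>'" if "j \<in> J" and eq: "\<And>i. i \<in> K j \<Longrightarrow> \<omega> i = \<omega>' i" for j \<omega> \<omega>'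
    proof (cases j)
      case None
      then have "root_state d \<omega> n \<tau> = root_state d \<omega>' n \<tau>"
        using eq by (intro root_state_cong) (auto simp: K_def)
      then show ?thesis by (simp add: P_def None)
    next
      case (Some v)
      then have "game_step d \<omega> \<sigma> v = game_step d \<omega>' \<sigma> v"
        using eq by (simp add: game_step_def K_def cong: conj_cong)
      then show ?thesis by (simp add: P_def Some)
    qed
  qed
  also have "\<dots> = prob {\<omega> \<in> space M. root_state d \<omega> n \<tau> = s} *
      (\<Prod>v\<in>level d n. prob {\<omega> \<in> space M. game_step d \<omega> \<sigma> v = \<tau> v})"
    unfolding J_def by (subst prod.insert) (auto simp: prod.reindex P_def)
  also have "(\<Prod>v\<in>level d n. prob {\<omega> \<in> space M. game_step d \<omega> \<sigma> v = \<tau> v})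
      = pmf (pta_step d (bond_pta d p q) n \<sigma>) \<tau>"
    \<comment> \<open>\<open>\<tau>\<close> is extensional, so it takes the default value
      \<open>undefined\<close> off the generation and its mass is the plain product.\<close>
    unfolding pta_step_def using \<tau>
    by (subst pmf_Pi'[OF finite_level]) (auto intro!: prod.cong prob_game_step simp: level_def PiE_def extensional_def)
  finally show ?thesis by (simp only: mult.commute)
qed

text \<open>Total probability over the configuration on generation \<open>n\<close>: by independence
  each term factors, and the sum is the \<open>bind_pmf\<close> in \<open>pta_law\<close>.\<close>

lemma prob_root_state:
  "prob {\<omega> \<in> space M. root_state d \<omega> n \<sigma> = s} = pmf (pta_law d (bond_pta d p q) n \<sigma>) s"
proof (induction n arbitrary: \<sigma>)
  case 0
  then show ?case by (cases "\<sigma> [] = s") (simp_all add: prob_space)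
next
  case (Suc n)
  let ?T = "level d n \<rightarrow>\<^sub>E (UNIV :: state set)"
  let ?step = "\<lambda>\<omega>. restrict (game_step d \<omega> \<sigma>) (level d n)"
  let ?A = "\<lambda>\<tau>. {\<omega> \<in> space M. ?step \<omega> = \<tau> \<and> root_state d \<omega> n \<tau> = s}"
  have fin: "finite ?T" by (intro finite_PiE) auto
  have meas: "?A \<tau> \<in> sets M" for \<tau>
  proof (rule sets_finitely_determined[OF finite_edges_le[of d "Suc n"]])
    fix \<omega> \<omega>' :: "nat list \<Rightarrow> label"
    assume eq: "\<And>e. e \<in> {e \<in> edges d. length e \<le> Suc n} \<Longrightarrow> \<omega> e = \<omega>' e"
    have "root_state d \<omega> n \<tau> = root_state d \<omega>' n \<tau>"
      using eq by (intro root_state_cong) auto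
    moreover have "\<omega> (v @ [k]) = \<omega>' (v @ [k])" if "v \<in> level d n" "k < d" for v k
      using that child_in_edges[of v d k] by (intro eq) (auto simp: level_def)
    then have "?step \<omega> = ?step \<omega>'"
      by (intro restrict_ext) (simp add: game_step_def cong: conj_cong)
    ultimately show "(?step \<omega> = \<tau> \<and> root_state d \<omega> n \<tau> = s) =
        (?step \<omega>' = \<tau> \<and> root_state d \<omega>' n \<tau> = s)" by simp
  qed auto
  have "{\<omega> \<in> space M. root_state d \<omega> (Suc n) \<sigma> = s} = (\<Union>\<tau>\<in>?T. ?A \<tau>)"
    by auto
  also have "prob \<dots> = (\<Sum>\<tau>\<in>?T. prob (?A \<tau>))"
    using meas by (intro finite_measure_finite_Union fin) (auto simp: disjoint_family_on_def)
  also have "\<dots> = (\<Sum>\<tau>\<in>?T. pmf (pta_law d (bond_pta d p q) n \<tau>) s *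
      pmf (pta_step d (bond_pta d p q) n \<sigma>) \<tau>)"
    by (intro sum.cong refl) (simp add: prob_step_and_root_state Suc.IH mult.commute)
  also have "\<dots> = pmf (pta_law d (bond_pta d p q) (Suc n) \<sigma>) s"
  proof -
    \<comment> \<open>The support lies in the finite set \<open>?T\<close>, so the integral coming
      from \<open>bind_pmf\<close> is a finite sum.\<close>
    have "\<tau> \<in> ?T" if "\<tau> \<in> set_pmf (pta_step d (bond_pta d p q) n \<sigma>)" for \<tau>
      using that set_Pi_pmf_subset[OF finite_level] unfolding pta_step_def
      by (fastforce simp: PiE_def extensional_def)
    then show ?thesis
      by (subst pta_law.simps, subst pmf_bind, subst integral_measure_pmf_real[OF fin]) auto
  qed
  finally show ?case .
qed

lemma prob_root_state_in:
  "prob {\<omega> \<in> space M. root_state d \<omega> n \<sigma> \<in> A}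
    = measure_pmf.prob (pta_law d (bond_pta d p q) n \<sigma>) A"
proof -
  have "{\<omega> \<in> space M. root_state d \<omega> n \<sigma> \<in> A} = (\<Union>s\<in>A. {\<omega> \<in> space M. root_state d \<omega> n \<sigma> = s})"
    by auto
  also have "prob \<dots> = (\<Sum>s\<in>A. prob {\<omega> \<in> space M. root_state d \<omega> n \<sigma> = s})"
    using sets_root_state by (intro finite_measure_finite_Union) (auto simp: disjoint_family_on_def)
  also have "\<dots> = measure_pmf.prob (pta_law d (bond_pta d p q) n \<sigma>) A"
    by (simp add: prob_root_state measure_measure_pmf_finite)
  finally show ?thesis .
qed

section \<open>Total variation distance and the draw probability\<close>

text \<open>The \<delta>_n of the outline: by \<open>root_state_D_iff\<close>, neither player can
  force a win within \<open>n\<close> rounds.\<close>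

definition draw_within :: "nat \<Rightarrow> real" where
  "draw_within n = prob {\<omega> \<in> space M. root_state d \<omega> n (\<lambda>_. D) = D}"

text \<open>Continuity from above. A longer horizon only helps the players, so the events decrease;
  a player who can win at all can do so within a bounded number of rounds, so their intersection is
  the draw event.\<close>

lemma draw_within_tendsto:
  assumes "0 < d"
  shows "draw_within \<longlonglongrightarrow> draw_prob d p q"
proof -
  let ?A = "\<lambda>n. {\<omega> \<in> space M. root_state d \<omega> n (\<lambda>_. D) = D}"
  have A: "?A n = {\<omega> \<in> space M. \<not> wins_within d First n [] \<omega> \<and> \<not> wins_within d Second n [] \<omega>}" for n
    by (simp add: root_state_D_iff)
  have "has_winning_strategy d \<omega> P \<longleftrightarrow> (\<exists>n. wins_within d P n [] \<omega>)" for \<omega> P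
    using wins_within_imp_winning[OF _ assms] winning_imp_wins_within by blast
  then have "draw_event d p q = (\<Inter>n. ?A n)"
    unfolding A by (auto simp: draw_event_def game_draw_def)
  moreover have "decseq ?A"
    unfolding A decseq_def using wins_within_mono by blast
  ultimately show ?thesis
    unfolding draw_within_def draw_prob_def
    using finite_Lim_measure_decseq[of ?A] sets_root_state[where R = "\<lambda>s. s = D"] by auto
qed

text \<open>Coupling through shared labels: off \<open>?C\<close> every boundary gives the root
  state of the all-\<open>D\<close> boundary, so two root states can differ only on
  \<open>?C\<close>.\<close>

lemma tv_dist_pta_law_le:
  "tv_dist (pta_law d (bond_pta d p q) n \<sigma>) (pta_law d (bond_pta d p q) n \<tau>) \<le> draw_within n"
  unfolding tv_dist_def
proof (rule cSUP_least)
  fix A :: "state set"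
  let ?B = "\<lambda>\<sigma>. {\<omega> \<in> space M. root_state d \<omega> n \<sigma> \<in> A}"
  let ?C = "{\<omega> \<in> space M. root_state d \<omega> n (\<lambda>_. D) = D}"
  have le: "prob (?B \<sigma>) \<le> prob (?B \<tau>) + draw_within n" for \<sigma> \<tau>
  proof -
    have "?B \<sigma> \<subseteq> ?B \<tau> \<union> ?C"
      using root_state_refines[where \<sigma> = "\<lambda>_. D" and \<tau> = \<sigma>]
        root_state_refines[where \<sigma> = "\<lambda>_. D" and \<tau> = \<tau>] by force
    then have "prob (?B \<sigma>) \<le> prob (?B \<tau> \<union> ?C)"
      by (intro finite_measure_mono sets.Un sets_root_state)
    also have "\<dots> \<le> prob (?B \<tau>) + prob ?C"
      by (intro measure_Un_le sets_root_state)
    finally show ?thesis by (simp add: draw_within_def)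
  qed
  show "\<bar>measure_pmf.prob (pta_law d (bond_pta d p q) n \<sigma>) A
      - measure_pmf.prob (pta_law d (bond_pta d p q) n \<tau>) A\<bar> \<le> draw_within n"
    using le[of \<sigma> \<tau>] le[of \<tau> \<sigma>] by (simp add: prob_root_state_in[symmetric] abs_le_iff)
qed simp

text \<open>The test set \<open>{D}\<close> suffices, since a boundary free of \<open>D\<close>
  gives it mass zero.\<close>

lemma tv_dist_pta_law_ge:
  assumes "\<And>v. v \<in> level d n \<Longrightarrow> \<sigma> v = D" "\<And>v. v \<in> level d n \<Longrightarrow> \<tau> v \<noteq> D"
  shows "draw_within n \<le> tv_dist (pta_law d (bond_pta d p q) n \<sigma>) (pta_law d (bond_pta d p q) n \<tau>)"
proof -
  let ?P = "measure_pmf.prob (pta_law d (bond_pta d p q) n \<sigma>)"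
  let ?Q = "measure_pmf.prob (pta_law d (bond_pta d p q) n \<tau>)"
  have "?P {D} = draw_within n"
    \<comment> \<open>\<open>\<sigma>\<close> is known to be \<open>D\<close> only on generation
      \<open>n\<close>, while \<open>draw_within\<close> uses the constant function;
      \<open>root_state_D_iff\<close> identifies both events.\<close>
    using assms(1) by (simp add: draw_within_def prob_root_state_in[symmetric] root_state_D_iff)
  moreover have "?Q {D} = 0"
    using root_state_neq_D[OF assms(2)] by (simp add: prob_root_state_in[symmetric])
  moreover have "draw_within n \<ge> 0" by (simp add: draw_within_def)
  ultimately have "draw_within n = \<bar>?P {D} - ?Q {D}\<bar>" by simp
  also have "\<dots> \<le> (SUP A. \<bar>?P A - ?Q A\<bar>)"
  proof (rule cSUP_upper)
    \<comment> \<open>A real supremum bounds its family only if that is bounded above.\<close>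
    have "\<bar>?P A - ?Q A\<bar> \<le> 1" for A
      using measure_pmf.prob_le_1 measure_nonneg by (smt (verit))
    then show "bdd_above (range (\<lambda>A. \<bar>?P A - ?Q A\<bar>))" by (intro bdd_aboveI2)
  qed simp
  finally show ?thesis by (simp add: tv_dist_def)
qed

text \<open>The upper bound is attained at all \<open>D\<close> against all \<open>W\<close>.
  Equality, not just a bound, gives both directions of the equivalence.\<close>

lemma SUP_tv_dist_pta_law:
  "(SUP \<sigma>\<in>level d n \<rightarrow>\<^sub>E UNIV. SUP \<tau>\<in>level d n \<rightarrow>\<^sub>E UNIV.
      ereal (tv_dist (pta_law d (bond_pta d p q) n \<sigma>) (pta_law d (bond_pta d p q) n \<tau>)))
    = ereal (draw_within n)"
proof (rule antisym)
  \<comment> \<open>Boundaries range over extensional functions, so constants are restricted to the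
    generation.\<close>
  let ?c = "\<lambda>s. restrict (\<lambda>_. s) (level d n)"
  have c: "?c s \<in> level d n \<rightarrow>\<^sub>E UNIV" for s :: state
    by (auto simp: PiE_def)
  have "ereal (draw_within n) \<le>
      ereal (tv_dist (pta_law d (bond_pta d p q) n (?c D)) (pta_law d (bond_pta d p q) n (?c W)))"
    using tv_dist_pta_law_ge[of n "?c D" "?c W"] by simp
  also have "\<dots> \<le> (SUP \<tau>\<in>level d n \<rightarrow>\<^sub>E UNIV.
      ereal (tv_dist (pta_law d (bond_pta d p q) n (?c D)) (pta_law d (bond_pta d p q) n \<tau>)))"
    by (rule SUP_upper) (rule c)
  also have "\<dots> \<le> (SUP \<sigma>\<in>level d n \<rightarrow>\<^sub>E UNIV. SUP \<tau>\<in>level d n \<rightarrow>\<^sub>E UNIV.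
      ereal (tv_dist (pta_law d (bond_pta d p q) n \<sigma>) (pta_law d (bond_pta d p q) n \<tau>)))"
    by (rule SUP_upper) (rule c)
  finally show "ereal (draw_within n) \<le> \<dots>" .
qed (auto intro!: SUP_least tv_dist_pta_law_le)

end

theorem theorem5p2:
  fixes d :: nat and p q :: real
  assumes "d \<ge> 2"
    and "p \<in> {0..1}" and "q \<in> {0..1}"
    and "0 < p + q" and "p + q < 1"
  shows "draw_prob d p q = 0 \<longleftrightarrow> pta_ergodic d (bond_pta d p q)"
proof -
  interpret bond_percolation d p q
    by unfold_locales (use assms in auto)
  have "(\<lambda>n. ereal (draw_within n)) \<longlonglongrightarrow> ereal (draw_prob d p q)"
    using draw_within_tendsto assms(1) by simp
  then have "limsup (\<lambda>n. ereal (draw_within n)) = ereal (draw_prob d p q)"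
    by (rule lim_imp_Limsup[OF sequentially_bot])
  \<comment> \<open>Ergodicity now reads \<open>ereal (draw_prob d p q) = 0\<close>.\<close>
  then show ?thesis
    by (simp add: pta_ergodic_def SUP_tv_dist_pta_law)
qed

end
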